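(* Let $\Omega$ be a sequentially compact topological space with a probability Borel measure $\mu$. Then for each $N$-dimensional real linear subspace $X_N$ of $L_1(\Omega,\mu)\cap C(\Omega)$ there exist a set of $N$ points $\{\xi^1,\dots,\xi^N\}\subset\Omega$ and nonnegative real numbers $\lambda_1,\dots,\lambda_N$ such that $$\int_\Omega f(x)\,d\mu(x)=\sum_{j=1}^N\lambda_j f(\xi^j)\qquad\text{for all } f\in X_N .$$
   Context: $C(\Omega)$ denotes the space of continuous real-valued functions on $\Omega$, and $L_1(\Omega,\mu)\cap C(\Omega)$ is the space of those that are $\mu$-integrable. Convention: nodes of cubature formulas are not required to be distinct. *)

theory Defs
  imports "HOL-Probability.Probability_Measure" "HOL-Library.Function_Algebras"
begin

text \<open>
  The library puts no scalar multiplication on the full function space, so the real vector space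
  of all functions \<open>'a \<Rightarrow> real\<close> is obtained from the locale \<^locale>\<open>vector_space\<close>, with the
  pointwise addition of \<^theory>\<open>HOL-Library.Function_Algebras\<close>.
\<close>

definition fun_scale :: "real \<Rightarrow> ('a \<Rightarrow> real) \<Rightarrow> 'a \<Rightarrow> real" where
  "fun_scale c f = (\<lambda>x. c * f x)"

global_interpretation fun_vs: vector_space "fun_scale :: real \<Rightarrow> ('a \<Rightarrow> real) \<Rightarrow> 'a \<Rightarrow> real"
  by unfold_locales (simp_all add: fun_scale_def fun_eq_iff algebra_simps)

text \<open>
  A finite basis is required explicitly: \<open>fun_vs.dim X = N\<close> alone would admit
  infinite-dimensional spaces when \<open>N = 0\<close>.
\<close>

definition n_dim_subspace :: "nat \<Rightarrow> ('a \<Rightarrow> real) set \<Rightarrow> bool" where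
  "n_dim_subspace N X \<longleftrightarrow> fun_vs.subspace X \<and>
     (\<exists>B. finite B \<and> card B = N \<and> fun_vs.independent B \<and> fun_vs.span B = X)"

text \<open>Functions, not classes modulo equality almost everywhere.\<close>

definition L1_continuous :: "'a::topological_space measure \<Rightarrow> ('a \<Rightarrow> real) set" where
  "L1_continuous M = {f. continuous_on UNIV f \<and> integrable M f}"

end

theory Submission
  imports Defs
begin

text \<open>
  Grouping the points of \<open>\<Omega>\<close> by the approximate values of finitely many bounded functions shows that
  the integral of these functions is a limit of finite nonnegative combinations of point evaluations.
  By the conic form of Caratheodory's theorem the number of nodes can be kept fixed, and when
  the constant \<open>1\<close> is among the functions the weights stay bounded. Sequential compactness
  then yields an exact formula in the limit, and dropping the constant function, a second use of
  Caratheodory's theorem reduces the number of nodes to \<open>N\<close>.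
\<close>

section \<open>Linear relations and the conic Caratheodory theorem\<close>

text \<open>Gaussian elimination, with \<open>B\<close> indexing the equations and \<open>J\<close>
  the unknowns: an equation with a nonzero coefficient is used to eliminate one unknown, so both
  cardinalities drop by one and the strict inequality survives.\<close>

lemma underdetermined_system_nontrivial_solution:
  fixes g :: "'b \<Rightarrow> 'i \<Rightarrow> real"
  assumes "finite B" "finite J" "card B < card J"
  shows "\<exists>d. (\<exists>j\<in>J. d j \<noteq> 0) \<and> (\<forall>b\<in>B. (\<Sum>j\<in>J. d j * g b j) = 0)"
  using assms
proof (induction B arbitrary: g J rule: finite_induct)
  case empty
  then have "J \<noteq> {}" by auto
  then show ?case by (intro exI[of _ "\<lambda>_. 1"]) auto
next
  case (insert b B)
  show ?case
  proof (cases "\<forall>j\<in>J. g b j = 0")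
    case True
    obtain d where "\<exists>j\<in>J. d j \<noteq> 0" "\<forall>b\<in>B. (\<Sum>j\<in>J. d j * g b j) = 0"
      using insert.IH[of J g] insert.prems insert.hyps by auto
    with True show ?thesis by (intro exI[of _ d]) auto
  next
    case False
    then obtain q where q: "q \<in> J" "g b q \<noteq> 0" by auto
    \<comment> \<open>The coefficients that remain once equation \<open>b\<close> has been solved
      for unknown \<open>q\<close> and substituted into the others.\<close>
    define h where "h i j = g i j - g i q * g b j / g b q" for i j
    have "card B < card (J - {q})"
      using insert q by (simp add: card_Diff_singleton)
    then obtain d where d: "\<exists>j\<in>J-{q}. d j \<noteq> 0" "\<forall>i\<in>B. (\<Sum>j\<in>J-{q}. d j * h i j) = 0"
      using insert.IH[of "J - {q}" h] insert.prems by auto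
    \<comment> \<open>Back substitution: equation \<open>b\<close> forces the value
      \<open>- D\<close> on unknown \<open>q\<close>.\<close>
    define D where "D = (\<Sum>j\<in>J-{q}. d j * g b j) / g b q"
    define e where "e = d(q := - D)"
    have e: "(\<Sum>j\<in>J. e j * g i j) = (\<Sum>j\<in>J-{q}. d j * g i j) - D * g i q" for i
    proof -
      have "(\<Sum>j\<in>J. e j * g i j) = e q * g i q + (\<Sum>j\<in>J-{q}. e j * g i j)"
        using q insert.prems by (simp add: sum.remove)
      also have "(\<Sum>j\<in>J-{q}. e j * g i j) = (\<Sum>j\<in>J-{q}. d j * g i j)"
        by (rule sum.cong) (auto simp: e_def)
      finally show ?thesis by (simp add: e_def)
    qed
    have "(\<Sum>j\<in>J-{q}. d j * h i j) = (\<Sum>j\<in>J-{q}. d j * g i j) - D * g i q" for i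
      unfolding h_def D_def
      by (simp add: right_diff_distrib sum_subtractf sum_divide_distrib sum_distrib_right
            sum_distrib_left mult_ac)
    with d e have "\<forall>i\<in>B. (\<Sum>j\<in>J. e j * g i j) = 0" by simp
    moreover have "(\<Sum>j\<in>J. e j * g b j) = 0"
      using q by (simp add: e D_def)
    moreover have "\<exists>j\<in>J. e j \<noteq> 0" using d by (auto simp: e_def)
    ultimately show ?thesis by auto
  qed
qed

text \<open>As long as there are more terms than functions, the vectors of values satisfy a
  nontrivial linear relation; subtracting a suitable multiple of it kills one coefficient and keeps
  the others nonnegative. The weights need not sum to one, so the bound is \<open>card B\<close> and
  not \<open>card B + 1\<close>.\<close>

lemma conic_caratheodory:
  fixes g :: "'b \<Rightarrow> 'i \<Rightarrow> real" and c :: "'i \<Rightarrow> real"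
  assumes "finite B" "finite J" "\<forall>j\<in>J. 0 \<le> c j"
  shows "\<exists>K c'. K \<subseteq> J \<and> card K \<le> card B \<and> (\<forall>j\<in>K. 0 \<le> c' j) \<and>
           (\<forall>b\<in>B. (\<Sum>j\<in>K. c' j * g b j) = (\<Sum>j\<in>J. c j * g b j))"
  using assms(2,3)
proof (induction "card J" arbitrary: J c rule: less_induct)
  case less
  show ?case
  proof (cases "card J \<le> card B")
    case True
    with less show ?thesis by (intro exI[of _ J] exI[of _ c]) auto
  next
    case False
    then obtain d where d: "\<exists>j\<in>J. d j \<noteq> 0" "\<forall>b\<in>B. (\<Sum>j\<in>J. d j * g b j) = 0"
      using underdetermined_system_nontrivial_solution[of B J g] assms less.prems by auto
    \<comment> \<open>After a change of sign if necessary, subtracting the relation decreases at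
      least one coefficient.\<close>
    have "\<exists>d. (\<exists>j\<in>J. d j > 0) \<and> (\<forall>b\<in>B. (\<Sum>j\<in>J. d j * g b j) = 0)"
    proof (cases "\<exists>j\<in>J. d j > 0")
      case False
      with d have "\<exists>j\<in>J. - d j > 0" by (metis neg_0_less_iff_less not_less_iff_gr_or_eq)
      with d show ?thesis by (intro exI[of _ "\<lambda>j. - d j"]) (auto simp: sum_negf)
    qed (use d in auto)
    then obtain d where d: "\<exists>j\<in>J. d j > 0" "\<forall>b\<in>B. (\<Sum>j\<in>J. d j * g b j) = 0" by auto
    define J' where "J' = {j\<in>J. d j > 0}"
    have J': "finite J'" "J' \<noteq> {}" using d less.prems by (auto simp: J'_def)
    \<comment> \<open>The largest multiple of the relation that can be subtracted without making a
      coefficient negative; an index attaining the minimum is dropped.\<close>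
    define t where "t = Min ((\<lambda>j. c j / d j) ` J')"
    have "t \<in> (\<lambda>j. c j / d j) ` J'" unfolding t_def using J' by (intro Min_in) auto
    then obtain q where q: "q \<in> J'" "t = c q / d q" by auto
    have t_le: "t \<le> c j / d j" if "j \<in> J'" for j
      unfolding t_def using J' that by (intro Min_le) auto
    have t0: "t \<ge> 0" using q less.prems by (auto simp: J'_def)
    define e where "e j = c j - t * d j" for j
    have e0: "e j \<ge> 0" if "j \<in> J" for j
    proof (cases "d j > 0")
      case True
      with t_le[of j] that show ?thesis by (simp add: e_def J'_def field_simps)
    next
      case False
      then have "t * d j \<le> 0" using t0 by (simp add: mult_nonneg_nonpos)
      with that less.prems show ?thesis by (auto simp: e_def intro: order_trans[of _ 0])
    qed
    have qJ: "q \<in> J" and eq: "e q = 0" using q by (auto simp: e_def J'_def)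
    have sum_e: "(\<Sum>j\<in>J-{q}. e j * g b j) = (\<Sum>j\<in>J. c j * g b j)" if "b \<in> B" for b
    proof -
      have "(\<Sum>j\<in>J-{q}. e j * g b j) = (\<Sum>j\<in>J. e j * g b j)"
        using qJ eq less.prems by (simp add: sum.remove)
      also have "\<dots> = (\<Sum>j\<in>J. c j * g b j) - t * (\<Sum>j\<in>J. d j * g b j)"
        by (simp add: e_def algebra_simps sum_subtractf sum_distrib_left)
      finally show ?thesis using d that by simp
    qed
    have "card (J - {q}) < card J" using qJ less.prems by (meson card_Diff1_less)
    from less.hyps[OF this, of e] less.prems e0 obtain K c'
      where "K \<subseteq> J - {q}" "card K \<le> card B" "\<forall>j\<in>K. 0 \<le> c' j"
        "\<forall>b\<in>B. (\<Sum>j\<in>K. c' j * g b j) = (\<Sum>j\<in>J-{q}. e j * g b j)" by auto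
    with sum_e show ?thesis by (intro exI[of _ K] exI[of _ c']) auto
  qed
qed

text \<open>Transfers the reduced sum to a prescribed index set \<open>I\<close>, padding with zero
  weights. This keeps the index set constant along a sequence of approximations and later allows
  \<open>{1..N}\<close>; nodes may repeat.\<close>

lemma conic_caratheodory_nodes:
  fixes B :: "('a \<Rightarrow> real) set" and x :: "'i \<Rightarrow> 'a" and c :: "'i \<Rightarrow> real"
  assumes "finite B" "finite J" "\<forall>j\<in>J. 0 \<le> c j" "finite I" "card B \<le> card I"
  shows "\<exists>(\<xi> :: 'k \<Rightarrow> 'a) c'. (\<forall>i\<in>I. 0 \<le> c' i) \<and>
           (\<forall>f\<in>B. (\<Sum>i\<in>I. c' i * f (\<xi> i)) = (\<Sum>j\<in>J. c j * f (x j)))"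
proof -
  obtain K c' where K: "K \<subseteq> J" "card K \<le> card B" "\<forall>j\<in>K. 0 \<le> c' j"
    "\<forall>f\<in>B. (\<Sum>j\<in>K. c' j * f (x j)) = (\<Sum>j\<in>J. c j * f (x j))"
    using conic_caratheodory[OF assms(1-3), of "\<lambda>f j. f (x j)"] by auto
  have "finite K" using K assms finite_subset by blast
  then obtain h where h: "h ` K \<subseteq> I" "inj_on h K"
    using K assms card_le_inj[of K I] by (meson le_trans)
  \<comment> \<open>Off the image of \<open>h\<close> this is an unspecified index, which is
    harmless because the weight there is zero.\<close>
  define k where "k = inv_into K h"
  have *: "(\<Sum>i\<in>I. (if i \<in> h ` K then c' (k i) else 0) * f (x (k i))) = (\<Sum>j\<in>K. c' j * f (x j))" for f
  proof -
    have "(\<Sum>i\<in>I. (if i \<in> h ` K then c' (k i) else 0) * f (x (k i)))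
          = (\<Sum>i\<in>h ` K. (if i \<in> h ` K then c' (k i) else 0) * f (x (k i)))"
      using h assms by (intro sum.mono_neutral_right) auto
    also have "\<dots> = (\<Sum>j\<in>K. c' j * f (x j))"
      using h by (simp add: sum.reindex k_def)
    finally show ?thesis .
  qed
  have "0 \<le> (if i \<in> h ` K then c' (k i) else 0)" for i
    using K h by (auto simp: k_def)
  with * K show ?thesis
    by (intro exI[of _ "\<lambda>i. x (k i)"] exI[of _ "\<lambda>i. if i \<in> h ` K then c' (k i) else 0"]) simp
qed

section \<open>Approximation of integrals by finite sums\<close>

text \<open>Points are put in the same cell when all \<open>f x / \<epsilon>\<close> have the same
  floor. Boundedness leaves finitely many cells, each represented by one of its points and weighted
  by its measure. The pointwise error is at most \<open>\<epsilon>\<close> and the total mass is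
  one.\<close>

lemma (in prob_space) integral_approx_finite_sum:
  fixes B :: "('a \<Rightarrow> real) set"
  assumes "finite B" "\<And>f. f \<in> B \<Longrightarrow> f \<in> borel_measurable M"
    and bdd: "\<And>f. f \<in> B \<Longrightarrow> bounded (f ` space M)" and "\<epsilon> > 0"
  shows "\<exists>P c. finite P \<and> (\<forall>p\<in>P. 0 \<le> c p) \<and>
           (\<forall>f\<in>B. \<bar>(\<integral>x. f x \<partial>M) - (\<Sum>p\<in>P. c p * f p)\<bar> \<le> \<epsilon>)"
proof -
  note [measurable] = assms(2)
  \<comment> \<open>The label of the cell of \<open>x\<close>, restricted to \<open>B\<close> so
    that all labels lie in a finite extensional product.\<close>
  define k where "k x = (\<lambda>f\<in>B. \<lfloor>f x / \<epsilon>\<rfloor>)" for x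
  have fin: "finite (k ` space M)"
  proof (rule finite_subset)
    show "k ` space M \<subseteq> (\<Pi>\<^sub>E f\<in>B. (\<lambda>x. \<lfloor>f x / \<epsilon>\<rfloor>) ` space M)"
      by (auto simp: k_def PiE_def Pi_def)
    have "finite ((\<lambda>x. \<lfloor>f x / \<epsilon>\<rfloor>) ` space M)" if f: "f \<in> B" for f
    proof -
      obtain C where C: "\<forall>y\<in>f ` space M. norm y \<le> C" using bdd[OF f] by (auto simp: bounded_iff)
      have "(\<lambda>x. \<lfloor>f x / \<epsilon>\<rfloor>) ` space M \<subseteq> {\<lfloor>- C / \<epsilon>\<rfloor>..\<lfloor>C / \<epsilon>\<rfloor>}"
      proof clarify
        fix x assume "x \<in> space M"
        with C have "\<bar>f x\<bar> \<le> C" by auto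
        then have "- C \<le> f x" "f x \<le> C" by linarith+
        then have "- C / \<epsilon> \<le> f x / \<epsilon>" "f x / \<epsilon> \<le> C / \<epsilon>"
          using \<open>\<epsilon> > 0\<close> by (blast intro: divide_right_mono less_imp_le)+
        then show "\<lfloor>f x / \<epsilon>\<rfloor> \<in> {\<lfloor>- C / \<epsilon>\<rfloor>..\<lfloor>C / \<epsilon>\<rfloor>}" by (meson atLeastAtMost_iff floor_mono)
      qed
      then show ?thesis using finite_subset by blast
    qed
    with \<open>finite B\<close> show "finite (\<Pi>\<^sub>E f\<in>B. (\<lambda>x. \<lfloor>f x / \<epsilon>\<rfloor>) ` space M)" by (rule finite_PiE)
  qed
  \<comment> \<open>The representative depends on the label only, so it is the same throughout a
    cell.\<close>
  define h where "h x = inv_into (space M) k (k x)" for x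
  have h: "h x \<in> space M" "k (h x) = k x" if "x \<in> space M" for x
    using that by (auto simp: h_def inv_into_into f_inv_into_f)
  define P where "P = h ` space M"
  have "P = inv_into (space M) k ` k ` space M"
    by (auto simp: P_def h_def)
  with fin have finP: "finite P" by simp
  have P: "p \<in> space M" "h p = p" if "p \<in> P" for p
    using that h unfolding P_def h_def by auto
  have close: "\<bar>f x - f (h x)\<bar> \<le> \<epsilon>" if "f \<in> B" "x \<in> space M" for f x
  proof -
    have "\<lfloor>f x / \<epsilon>\<rfloor> = \<lfloor>f (h x) / \<epsilon>\<rfloor>"
      using fun_cong[OF h(2)[OF that(2)], of f] that(1) by (simp add: k_def)
    then have "\<bar>f x / \<epsilon> - f (h x) / \<epsilon>\<bar> \<le> 1" by linarith
    then have "\<bar>f x - f (h x)\<bar> / \<epsilon> \<le> 1"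
      using \<open>\<epsilon> > 0\<close> by (simp flip: diff_divide_distrib)
    then show ?thesis using \<open>\<epsilon> > 0\<close> by simp
  qed
  define A where "A p = {x\<in>space M. h x = p}" for p
  have A [measurable]: "A p \<in> sets M" if "p \<in> P" for p
  proof -
    \<comment> \<open>The choice made by \<open>h\<close> carries no measurability of its own; the
      cells are measurable because finitely many floor conditions describe them.\<close>
    have "A p = {x\<in>space M. \<forall>f\<in>B. \<lfloor>f x / \<epsilon>\<rfloor> = \<lfloor>f p / \<epsilon>\<rfloor>}"
    proof (intro set_eqI iffI; clarsimp simp: A_def)
      fix x f assume "x \<in> space M" "f \<in> B" "p = h x"
      then show "\<lfloor>f x / \<epsilon>\<rfloor> = \<lfloor>f (h x) / \<epsilon>\<rfloor>"
        using fun_cong[OF h(2)[of x], of f] by (simp add: k_def)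
    next
      fix x assume "x \<in> space M" "\<forall>f\<in>B. \<lfloor>f x / \<epsilon>\<rfloor> = \<lfloor>f p / \<epsilon>\<rfloor>"
      then have "k x = k p" by (auto simp: k_def)
      then have "h x = h p" by (simp add: h_def)
      then show "h x = p" using P that by simp
    qed
    also have "\<dots> \<in> sets M"
      using \<open>finite B\<close> by (intro sets.sets_Collect_finite_All) auto
    finally show ?thesis .
  qed
  have approx: "\<bar>(\<integral>x. f x \<partial>M) - (\<Sum>p\<in>P. measure M (A p) * f p)\<bar> \<le> \<epsilon>" if f: "f \<in> B" for f
  proof -
    \<comment> \<open>On the space, \<open>f\<close> composed with \<open>h\<close> is a simple
      function, which gives both its integrability and its integral.\<close>
    have fh: "f (h x) = (\<Sum>p\<in>P. indicator (A p) x * f p)" if "x \<in> space M" for x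
    proof -
      have "(\<Sum>p\<in>P. indicator (A p) x * f p) = (\<Sum>p\<in>P. if h x = p then f p else 0)"
        using that by (intro sum.cong) (auto simp: A_def)
      then show ?thesis using finP that by (simp add: P_def)
    qed
    have int_s: "integrable M (\<lambda>x. \<Sum>p\<in>P. indicator (A p) x * f p)"
      by (intro Bochner_Integration.integrable_sum integrable_mult_left)
         (auto simp: integrable_indicator_iff emeasure_eq_measure)
    have int_fh: "integrable M (\<lambda>x. f (h x))"
      using int_s by (subst Bochner_Integration.integrable_cong[OF refl fh])
    have int_f: "integrable M f"
    proof -
      obtain C where "\<forall>y\<in>f ` space M. norm y \<le> C" using bdd[OF f] by (auto simp: bounded_iff)
      then show ?thesis using f by (intro integrable_const_bound[of _ C]) auto
    qed
    have "(\<integral>x. f (h x) \<partial>M) = (\<integral>x. (\<Sum>p\<in>P. indicator (A p) x * f p) \<partial>M)"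
      by (intro Bochner_Integration.integral_cong refl fh)
    also have "\<dots> = (\<Sum>p\<in>P. measure M (A p) * f p)"
      by (subst Bochner_Integration.integral_sum)
         (auto simp: integrable_indicator_iff emeasure_eq_measure intro!: integrable_mult_left sum.cong)
    finally have "(\<integral>x. f x \<partial>M) - (\<Sum>p\<in>P. measure M (A p) * f p) = (\<integral>x. f x - f (h x) \<partial>M)"
      using int_f int_fh by simp
    also have "\<bar>\<dots>\<bar> \<le> (\<integral>x. \<bar>f x - f (h x)\<bar> \<partial>M)" by (rule integral_abs_bound)
    also have "\<dots> \<le> (\<integral>x. \<epsilon> \<partial>M)"
      using int_f int_fh close[OF f] by (intro integral_mono) auto
    finally show ?thesis by (simp add: prob_space)
  qed
  then show ?thesis using finP by (intro exI[of _ P] exI[of _ "\<lambda>p. measure M (A p)"]) auto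
qed

section \<open>Sequential compactness and passage to the limit\<close>

text \<open>Subsequences are refined one index at a time, so that a single \<open>r\<close> serves
  all of \<open>I\<close>. It is needed for the weights as well as for the nodes.\<close>

lemma seq_compact_finite_family_subseq:
  fixes x :: "nat \<Rightarrow> 'i \<Rightarrow> 'a::topological_space"
  assumes "seq_compact S" "finite I" "\<And>n i. i \<in> I \<Longrightarrow> x n i \<in> S"
  shows "\<exists>l r. strict_mono (r :: nat \<Rightarrow> nat) \<and> (\<forall>i\<in>I. l i \<in> S \<and> (\<lambda>n. x (r n) i) \<longlonglongrightarrow> l i)"
  using assms(2,3)
proof (induction I rule: finite_induct)
  case empty
  then show ?case using strict_mono_id by auto
next
  case (insert i I)
  then obtain l r where r: "strict_mono (r :: nat \<Rightarrow> nat)"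
    "\<forall>i\<in>I. l i \<in> S \<and> (\<lambda>n. x (r n) i) \<longlonglongrightarrow> l i" by auto
  obtain a s where s: "a \<in> S" "strict_mono (s :: nat \<Rightarrow> nat)" "((\<lambda>n. x (r n) i) \<circ> s) \<longlonglongrightarrow> a"
    using seq_compactE[OF assms(1), of "\<lambda>n. x (r n) i"] insert.prems by auto
  have "(\<lambda>n. x (r (s n)) j) \<longlonglongrightarrow> l j" if "j \<in> I" for j
    using LIMSEQ_subseq_LIMSEQ[OF _ s(2), of "\<lambda>n. x (r n) j"] r that by (simp add: comp_def)
  with r s insert.hyps show ?case
    by (intro exI[of _ "l(i := a)"] exI[of _ "r \<circ> s"]) (auto simp: strict_mono_def comp_def)
qed

text \<open>Continuity carries sequential compactness over to the image, and in the real line this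
  is compactness; \<open>S\<close> itself need not be compact.\<close>

lemma seq_compact_continuous_real_image_bounded:
  fixes f :: "'a::topological_space \<Rightarrow> real"
  assumes "seq_compact S" "continuous_on S f"
  shows "bounded (f ` S)"
proof -
  have "seq_compact (f ` S)"
  proof (rule seq_compactI)
    fix y :: "nat \<Rightarrow> real" assume "\<forall>n. y n \<in> f ` S"
    then have "\<forall>n. \<exists>x. x \<in> S \<and> y n = f x" by auto
    then obtain x where x: "\<And>n. x n \<in> S" "\<And>n. y n = f (x n)" by metis
    obtain l r where l: "l \<in> S" "strict_mono (r :: nat \<Rightarrow> nat)" "(x \<circ> r) \<longlonglongrightarrow> l"
      using seq_compactE[OF assms(1), of x] x by auto
    have "(\<lambda>n. f ((x \<circ> r) n)) \<longlonglongrightarrow> f l"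
      by (rule continuous_on_tendsto_compose[OF assms(2) l(3,1)]) (simp add: x(1))
    then have "(y \<circ> r) \<longlonglongrightarrow> f l" by (simp add: x comp_def)
    with l show "\<exists>l\<in>f ` S. \<exists>r. strict_mono r \<and> (y \<circ> r) \<longlonglongrightarrow> l" by blast
  qed
  then show ?thesis
    using compact_eq_seq_compact_metric compact_imp_bounded by blast
qed

lemma continuous_exact_cubature:
  fixes M :: "'a::topological_space measure" and B :: "('a \<Rightarrow> real) set"
  assumes sc: "seq_compact (UNIV :: 'a set)" and "prob_space M" and sets: "sets M = sets borel"
    and finB: "finite B" and cont: "\<And>f. f \<in> B \<Longrightarrow> continuous_on UNIV f"
  shows "\<exists>J (\<xi> :: ('a \<Rightarrow> real) \<Rightarrow> 'a) c. finite J \<and> (\<forall>j\<in>J. 0 \<le> c j) \<and>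
           (\<forall>f\<in>B. (\<integral>x. f x \<partial>M) = (\<Sum>j\<in>J. c j * f (\<xi> j)))"
proof -
  interpret prob_space M by fact
  have space: "space M = UNIV" using sets_eq_imp_space_eq[OF sets] by simp
  \<comment> \<open>The constant function has integral one, so approximating it well keeps the sum
    of the weights bounded.\<close>
  define C where "C = insert (\<lambda>_. 1) B"
  have finC: "finite C" and contC: "\<And>f. f \<in> C \<Longrightarrow> continuous_on UNIV f"
    using finB cont by (auto simp: C_def)
  have meas: "f \<in> borel_measurable M" if "f \<in> C" for f
    using borel_measurable_continuous_onI[OF contC[OF that]] measurable_cong_sets[OF sets refl] by blast
  have bdd: "bounded (f ` space M)" if "f \<in> C" for f
    using seq_compact_continuous_real_image_bounded[OF sc contC[OF that]] by (simp add: space)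
  \<comment> \<open>\<open>C\<close> plays two roles, as the family of functions and as the index
    set of the nodes: it has exactly the size that Caratheodory requires, and it does not vary with
    \<open>n\<close>.\<close>
  have "\<exists>\<xi> c. (\<forall>j\<in>C. 0 \<le> c j) \<and>
          (\<forall>f\<in>C. \<bar>(\<integral>x. f x \<partial>M) - (\<Sum>j\<in>C. c j * f (\<xi> j))\<bar> \<le> inverse (real (Suc n)))" for n
  proof -
    obtain P c where P: "finite P" "\<forall>p\<in>P. 0 \<le> c p"
      "\<forall>f\<in>C. \<bar>(\<integral>x. f x \<partial>M) - (\<Sum>p\<in>P. c p * f p)\<bar> \<le> inverse (real (Suc n))"
      using integral_approx_finite_sum[OF finC meas bdd, of "inverse (real (Suc n))"] by auto
    obtain \<xi> :: "('a \<Rightarrow> real) \<Rightarrow> 'a" and c' where "\<forall>i\<in>C. 0 \<le> c' i"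
      "\<forall>f\<in>C. (\<Sum>i\<in>C. c' i * f (\<xi> i)) = (\<Sum>p\<in>P. c p * f p)"
      using conic_caratheodory_nodes[OF finC P(1,2) finC order_refl, of "\<lambda>p. p"] by auto
    with P show ?thesis by (intro exI[of _ \<xi>] exI[of _ c']) auto
  qed
  then obtain \<xi> c where c0: "\<And>n j. j \<in> C \<Longrightarrow> 0 \<le> c n j"
    and approx: "\<And>n f. f \<in> C \<Longrightarrow>
      \<bar>(\<integral>x. f x \<partial>M) - (\<Sum>j\<in>C. c n j * f (\<xi> n j))\<bar> \<le> inverse (real (Suc n))"
    by metis
  \<comment> \<open>The weights are nonnegative and their sum is at most one plus the tolerance,
    hence at most 2.\<close>
  have c2: "c n j \<in> {0..2}" if "j \<in> C" for n j
  proof -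
    have "\<bar>1 - (\<Sum>j\<in>C. c n j)\<bar> \<le> inverse (real (Suc n))"
      using approx[of "\<lambda>_. 1" n] by (simp add: C_def prob_space)
    moreover have "inverse (real (Suc n)) \<le> 1" by (simp add: field_simps)
    moreover have "c n j \<le> (\<Sum>j\<in>C. c n j)"
      using that c0 finC by (intro member_le_sum) auto
    ultimately show ?thesis using c0[OF that] by auto
  qed
  have "seq_compact {0..2::real}" using compact_imp_seq_compact compact_Icc by blast
  from seq_compact_finite_family_subseq[OF this finC, of c, OF c2]
  obtain c' r where r: "strict_mono (r :: nat \<Rightarrow> nat)"
    "\<And>j. j \<in> C \<Longrightarrow> c' j \<in> {0..2}" "\<And>j. j \<in> C \<Longrightarrow> (\<lambda>n. c (r n) j) \<longlonglongrightarrow> c' j" by blast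
  \<comment> \<open>The nodes are extracted along \<open>r\<close>, so weights and nodes converge
    together along \<open>r\<close> composed with \<open>s\<close>.\<close>
  from seq_compact_finite_family_subseq[OF sc finC, of "\<lambda>n. \<xi> (r n)"]
  obtain \<xi>' s where s: "strict_mono (s :: nat \<Rightarrow> nat)"
    "\<And>j. j \<in> C \<Longrightarrow> (\<lambda>n. \<xi> (r (s n)) j) \<longlonglongrightarrow> \<xi>' j" by blast
  have c_lim: "(\<lambda>n. c (r (s n)) j) \<longlonglongrightarrow> c' j" if "j \<in> C" for j
    using LIMSEQ_subseq_LIMSEQ[OF r(3)[OF that] s(1)] by (simp add: comp_def)
  have "(\<integral>x. f x \<partial>M) = (\<Sum>j\<in>C. c' j * f (\<xi>' j))" if f: "f \<in> C" for f
  proof -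
    have "(\<lambda>n. f (\<xi> (r (s n)) j)) \<longlonglongrightarrow> f (\<xi>' j)" if "j \<in> C" for j
      by (rule continuous_on_tendsto_compose[OF contC[OF f] s(2)[OF that]]) auto
    then have lim: "(\<lambda>n. \<Sum>j\<in>C. c (r (s n)) j * f (\<xi> (r (s n)) j)) \<longlonglongrightarrow> (\<Sum>j\<in>C. c' j * f (\<xi>' j))"
      by (intro tendsto_sum tendsto_mult c_lim)
    have "(\<lambda>n. (\<Sum>j\<in>C. c n j * f (\<xi> n j)) - (\<integral>x. f x \<partial>M)) \<longlonglongrightarrow> 0"
      by (rule Lim_null_comparison[OF _ LIMSEQ_inverse_real_of_nat])
         (use approx[OF f] in \<open>auto simp: abs_minus_commute\<close>)
    then have "(\<lambda>n. \<Sum>j\<in>C. c n j * f (\<xi> n j)) \<longlonglongrightarrow> (\<integral>x. f x \<partial>M)"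
      by (rule LIM_zero_cancel)
    from LIMSEQ_subseq_LIMSEQ[OF this strict_mono_o[OF r(1) s(1)]]
    have "(\<lambda>n. \<Sum>j\<in>C. c (r (s n)) j * f (\<xi> (r (s n)) j)) \<longlonglongrightarrow> (\<integral>x. f x \<partial>M)"
      by (simp add: comp_def)
    from LIMSEQ_unique[OF this lim] show ?thesis .
  qed
  with finC r(2) show ?thesis
    by (intro exI[of _ C] exI[of _ \<xi>'] exI[of _ c']) (auto simp: C_def)
qed

section \<open>Reduction to \<open>N\<close> nodes and extension to the whole subspace\<close>

theorem theorem4p1:
  fixes \<mu> :: "'a::topological_space measure"
    and X :: "('a \<Rightarrow> real) set"
    and N :: nat
  assumes "seq_compact (UNIV :: 'a set)"
    and "prob_space \<mu>"
    and "sets \<mu> = sets borel"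
    and "n_dim_subspace N X"
    and "X \<subseteq> L1_continuous \<mu>"
  shows "\<exists>(\<xi> :: nat \<Rightarrow> 'a) (c :: nat \<Rightarrow> real).
           (\<forall>j\<in>{1..N}. 0 \<le> c j) \<and>
           (\<forall>f\<in>X. (\<integral>x. f x \<partial>\<mu>) = (\<Sum>j=1..N. c j * f (\<xi> j)))"
proof -
  obtain B where B: "finite B" "card B = N" "fun_vs.span B = X"
    using assms(4) by (auto simp: n_dim_subspace_def)
  have BX: "B \<subseteq> L1_continuous \<mu>"
    using fun_vs.span_superset[of B] B assms(5) by auto
  then have "\<And>f. f \<in> B \<Longrightarrow> continuous_on UNIV f" by (auto simp: L1_continuous_def)
  from continuous_exact_cubature[OF assms(1-3) B(1) this]
  obtain J and \<eta> :: "('a \<Rightarrow> real) \<Rightarrow> 'a" and d where J: "finite J" "\<forall>j\<in>J. 0 \<le> d j"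
    "\<forall>f\<in>B. (\<integral>x. f x \<partial>\<mu>) = (\<Sum>j\<in>J. d j * f (\<eta> j))" by blast
  \<comment> \<open>The limit formula may have one node too many because of the added constant.
    Reducing it against the basis \<open>B\<close> alone leaves \<open>N\<close> nodes.\<close>
  obtain \<xi> :: "nat \<Rightarrow> 'a" and c where c: "\<forall>i\<in>{1..N}. 0 \<le> c i"
    "\<forall>f\<in>B. (\<Sum>i\<in>{1..N}. c i * f (\<xi> i)) = (\<Sum>j\<in>J. d j * f (\<eta> j))"
    using conic_caratheodory_nodes[OF B(1) J(1,2), of "{1..N}" \<eta>] B(2) by auto
  \<comment> \<open>Exactness passes from \<open>B\<close> to its span because both sides are
    linear. Integrability is part of \<open>S\<close> since additivity of the integral relies on
    it.\<close>
  define S where "S = {f. integrable \<mu> f \<and> (\<integral>x. f x \<partial>\<mu>) = (\<Sum>i\<in>{1..N}. c i * f (\<xi> i))}"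
  have "fun_vs.subspace S"
    by (rule fun_vs.subspaceI)
       (auto simp: S_def fun_scale_def plus_fun_def zero_fun_def algebra_simps sum.distrib sum_distrib_left)
  moreover have "B \<subseteq> S" using BX J c by (auto simp: S_def L1_continuous_def)
  ultimately have "X \<subseteq> S" using fun_vs.span_minimal B by blast
  with c(1) show ?thesis by (intro exI[of _ \<xi>] exI[of _ c]) (auto simp: S_def)
qed

end
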